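(* Let $n$ be an odd positive integer greater than $1$, let $G=D_{2n}$ be the dihedral group of order $2n$, and let $H$ be a subgroup of $G$ of order $2$. Then $$|\mathcal{I}tp(G,H)|=\frac{P_{\mathrm{Aff}(1,n)}(2,2,\dots,2)}{2}.$$
   Context: A normalized right transversal (NRT) of a subgroup $H$ in a finite group $G$ is a subset $T\subseteq G$ with $1\in T$ containing exactly one element of each right coset $Hg$ of $H$ in $G$. $\mathcal{T}(G,H)$ denotes the set of all NRTs of $H$ in $G$. Each $T\in\mathcal{T}(G,H)$ carries the binary operation $\circ$ given by $\{u\circ v\}=Huv\cap T$, which makes $T$ a right loop (a right quasigroup with two-sided identity $1$). Two groupoids $(L_1,\circ_1)$ and $(L_2,\circ_2)$ are isotopic if there are bijections $f,g,h:L_1\to L_2$ with $f(u)\circ_2 g(v)=h(u\circ_1 v)$ for all $u,v\in L_1$. Two NRTs in $\mathcal{T}(G,H)$ are called isotopic if their induced right loops are isotopic. $\mathcal{I}tp(G,H)$ denotes the set of all isotopism classes of elements of $\mathcal{T}(G,H)$. $\mathrm{Aff}(1,n)$ is the one-dimensional affine group of $\mathbb{Z}_n$ (the ring of integers modulo $n$), i.e. the group of permutations $y\mapsto\nu y+u$ of $\mathbb{Z}_n$ with $\nu$ a unit of $\mathbb{Z}_n$ and $u\in\mathbb{Z}_n$. For a permutation group $\mathcal{S}$ on a finite set with $k$ elements, its cyclic index (cycle index) is the polynomial $$P_{\mathcal{S}}(x_1,\dots,x_k)=\frac{1}{|\mathcal{S}|}\sum_{\tau\in\mathcal{S}}x_1^{c_1(\tau)}\cdots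 x_k^{c_k(\tau)}\in\mathbb{Q}[x_1,\dots,x_k],$$ where $c_l(\tau)$ is the number of $l$-cycles in the disjoint cycle decomposition of $\tau$ (fixed points counted as $1$-cycles). *)

theory Defs
  imports
    "HOL-Algebra.Coset"
    "HOL-Number_Theory.Residues"
    "HOL-Combinatorics.Orbits"
begin

text \<open>With \<open>r\<close> the generating rotation and \<open>q\<close> a reflection, \<open>q r q\<close> being the inverse of \<open>r\<close>, the pair
  \<open>(a, s)\<close> stands for \<open>r\<close> to the power \<open>a\<close>, multiplied on the right by \<open>q\<close> if \<open>s\<close> is true.\<close>

definition dihedral_group :: "nat \<Rightarrow> (int \<times> bool) monoid" where
  "dihedral_group n =
     \<lparr>carrier = {0..<int n} \<times> UNIV,
      monoid.mult = (\<lambda>(a, s) (b, t). ((if s then a - b else a + b) mod int n, s \<noteq> t)),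
      one = (0, False)\<rparr>"

definition NRT :: "('a, 'b) monoid_scheme \<Rightarrow> 'a set \<Rightarrow> 'a set set" where
  "NRT G H = {T. T \<subseteq> carrier G \<and> \<one>\<^bsub>G\<^esub> \<in> T \<and> (\<forall>C \<in> rcosets\<^bsub>G\<^esub> H. \<exists>!t. t \<in> C \<inter> T)}"

definition nrt_op :: "('a, 'b) monoid_scheme \<Rightarrow> 'a set \<Rightarrow> 'a set \<Rightarrow> 'a \<Rightarrow> 'a \<Rightarrow> 'a" where
  "nrt_op G H T u v = (THE w. w \<in> (H #>\<^bsub>G\<^esub> (u \<otimes>\<^bsub>G\<^esub> v)) \<inter> T)"

definition isotopic ::
  "'a set \<Rightarrow> ('a \<Rightarrow> 'a \<Rightarrow> 'a) \<Rightarrow> 'b set \<Rightarrow> ('b \<Rightarrow> 'b \<Rightarrow> 'b) \<Rightarrow> bool" where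
  "isotopic L\<^sub>1 op\<^sub>1 L\<^sub>2 op\<^sub>2 \<longleftrightarrow>
     (\<exists>f g h. bij_betw f L\<^sub>1 L\<^sub>2 \<and> bij_betw g L\<^sub>1 L\<^sub>2 \<and> bij_betw h L\<^sub>1 L\<^sub>2 \<and>
        (\<forall>u\<in>L\<^sub>1. \<forall>v\<in>L\<^sub>1. op\<^sub>2 (f u) (g v) = h (op\<^sub>1 u v)))"

definition nrt_isotopy_rel :: "('a, 'b) monoid_scheme \<Rightarrow> 'a set \<Rightarrow> ('a set \<times> 'a set) set" where
  "nrt_isotopy_rel G H =
     {(S, T). S \<in> NRT G H \<and> T \<in> NRT G H \<and> isotopic S (nrt_op G H S) T (nrt_op G H T)}"

definition Itp :: "('a, 'b) monoid_scheme \<Rightarrow> 'a set \<Rightarrow> 'a set set set" where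
  "Itp G H = NRT G H // nrt_isotopy_rel G H"

text \<open>As usual for \<^const>\<open>permutes\<close>, the permutations are extended by the identity outside
  \<open>{0..<n}\<close>, the set of representatives of the integers modulo \<open>n\<close>.\<close>

definition Aff1 :: "nat \<Rightarrow> (int \<Rightarrow> int) set" where
  "Aff1 n =
     {(\<lambda>y. if y \<in> {0..<int n} then (\<nu> * y + u) mod int n else y) | \<nu> u.
        \<nu> \<in> Units (residue_ring (int n)) \<and> u \<in> carrier (residue_ring (int n))}"

text \<open>The cycles of a permutation of a finite set correspond to its orbits; a fixed point is an
  orbit with one element.\<close>

definition cycle_count :: "'a set \<Rightarrow> ('a \<Rightarrow> 'a) \<Rightarrow> nat \<Rightarrow> nat" where
  "cycle_count A \<tau> l = card {C \<in> orbit \<tau> ` A. card C = l}"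

text \<open>The cycle index of a set \<open>S\<close> of permutations of \<open>A\<close>, as a polynomial function of the
  variables \<open>x 1, \<dots>, x (card A)\<close>.\<close>

definition cycle_index :: "'a set \<Rightarrow> ('a \<Rightarrow> 'a) set \<Rightarrow> (nat \<Rightarrow> rat) \<Rightarrow> rat" where
  "cycle_index A S x =
     (1 / of_nat (card S)) * (\<Sum>\<tau>\<in>S. \<Prod>l = 1..card A. x l ^ cycle_count A \<tau> l)"

lemma group_dihedral_group:
  assumes "n > 0"
  shows "group (dihedral_group n)"
proof (rule groupI)
  fix x y z
  assume "x \<in> carrier (dihedral_group n)" "y \<in> carrier (dihedral_group n)"
    "z \<in> carrier (dihedral_group n)"
  show "x \<otimes>\<^bsub>dihedral_group n\<^esub> y \<otimes>\<^bsub>dihedral_group n\<^esub> z =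
    x \<otimes>\<^bsub>dihedral_group n\<^esub> (y \<otimes>\<^bsub>dihedral_group n\<^esub> z)"
    by (auto simp: dihedral_group_def mod_simps algebra_simps split: prod.splits)
next
  fix x assume x: "x \<in> carrier (dihedral_group n)"
  obtain a s where [simp]: "x = (a, s)" by force
  show "\<exists>y\<in>carrier (dihedral_group n). y \<otimes>\<^bsub>dihedral_group n\<^esub> x = \<one>\<^bsub>dihedral_group n\<^esub>"
    using x assms
    by (intro bexI[of _ "(if s then a else (- a) mod int n, s)"])
      (auto simp: dihedral_group_def mod_simps)
qed (use assms in \<open>auto simp: dihedral_group_def\<close>)

lemma order_dihedral_group: "order (dihedral_group n) = 2 * n"
  by (simp add: order_def dihedral_group_def card_cartesian_product)

lemma (in group) nrt_op_in:
  assumes "subgroup H G" "T \<in> NRT G H" "u \<in> T" "v \<in> T"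
  shows "nrt_op G H T u v \<in> (H #> (u \<otimes> v)) \<inter> T"
proof -
  have "u \<otimes> v \<in> carrier G"
    using assms by (auto simp: NRT_def)
  then have "H #> (u \<otimes> v) \<in> rcosets H"
    using subgroup.subset[OF assms(1)] by (rule rcosetsI[rotated])
  then have "\<exists>!t. t \<in> (H #> (u \<otimes> v)) \<inter> T"
    using assms(2) by (auto simp: NRT_def)
  then show ?thesis
    unfolding nrt_op_def by (rule theI')
qed

lemma isotopic_refl: "isotopic L m L m"
  unfolding isotopic_def by (intro exI[of _ id]) auto

lemma isotopic_sym:
  assumes "isotopic L m L' m'" and closed: "\<And>u v. u \<in> L \<Longrightarrow> v \<in> L \<Longrightarrow> m u v \<in> L"
  shows "isotopic L' m' L m"
proof -
  obtain f g h where bij: "bij_betw f L L'" "bij_betw g L L'" "bij_betw h L L'"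
    and eq: "\<And>u v. u \<in> L \<Longrightarrow> v \<in> L \<Longrightarrow> m' (f u) (g v) = h (m u v)"
    using assms(1) unfolding isotopic_def by blast
  let ?f = "inv_into L f" and ?g = "inv_into L g" and ?h = "inv_into L h"
  have "m (?f x) (?g y) = ?h (m' x y)" if "x \<in> L'" "y \<in> L'" for x y
  proof -
    have in_L: "?f x \<in> L" "?g y \<in> L"
      using bij that by (meson bij_betw_apply bij_betw_inv_into)+
    have "m' x y = h (m (?f x) (?g y))"
      using eq[OF in_L] bij that by (simp add: bij_betw_inv_into_right)
    then show ?thesis
      using bij(3) closed[OF in_L] by (simp add: bij_betw_inv_into_left)
  qed
  then show ?thesis
    unfolding isotopic_def using bij by (blast intro: bij_betw_inv_into)
qed

lemma isotopic_trans:
  assumes "isotopic L m L' m'" "isotopic L' m' L'' m''"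
  shows "isotopic L m L'' m''"
proof -
  obtain f g h where bij: "bij_betw f L L'" "bij_betw g L L'" "bij_betw h L L'"
    and eq: "\<And>u v. u \<in> L \<Longrightarrow> v \<in> L \<Longrightarrow> m' (f u) (g v) = h (m u v)"
    using assms(1) unfolding isotopic_def by blast
  obtain f' g' h' where bij': "bij_betw f' L' L''" "bij_betw g' L' L''" "bij_betw h' L' L''"
    and eq': "\<And>u v. u \<in> L' \<Longrightarrow> v \<in> L' \<Longrightarrow> m'' (f' u) (g' v) = h' (m' u v)"
    using assms(2) unfolding isotopic_def by blast
  have "m'' ((f' \<circ> f) u) ((g' \<circ> g) v) = (h' \<circ> h) (m u v)" if "u \<in> L" "v \<in> L" for u v
    using that eq[OF that] eq'[of "f u" "g v"] bij by (auto dest!: bij_betwE)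
  then show ?thesis
    unfolding isotopic_def using bij bij' by (blast intro: bij_betw_trans)
qed

lemma (in group) equiv_nrt_isotopy_rel:
  assumes "subgroup H G"
  shows "equiv (NRT G H) (nrt_isotopy_rel G H)"
proof (rule equivI)
  show "nrt_isotopy_rel G H \<subseteq> NRT G H \<times> NRT G H"
    by (auto simp: nrt_isotopy_rel_def)
  show "refl_on (NRT G H) (nrt_isotopy_rel G H)"
    by (auto simp: refl_on_def nrt_isotopy_rel_def isotopic_refl)
  show "sym (nrt_isotopy_rel G H)"
    using nrt_op_in[OF assms] by (auto simp: sym_def nrt_isotopy_rel_def intro: isotopic_sym)
  show "trans (nrt_isotopy_rel G H)"
    unfolding trans_def nrt_isotopy_rel_def by (auto intro: isotopic_trans)
qed

end

theory Submission
  imports Defs "HOL-Algebra.Group_Action"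
begin

text \<open>
  Let \<open>Z\<close> be the integers modulo \<open>n\<close>. Write \<open>H = {1, q}\<close>, where \<open>q\<close> is a reflection because \<open>n\<close> is odd, and
  write the elements of \<open>G\<close> as \<open>q\<^sup>s r\<^sup>i\<close> with \<open>s \<in> {0, 1}\<close> and \<open>i \<in> Z\<close>. The right cosets of \<open>H\<close> are
  indexed by \<open>i\<close>, so a normalized right transversal amounts to the set \<open>B\<close> of those \<open>i\<close> whose
  representative has \<open>s = 1\<close>; every subset \<open>B\<close> of \<open>Z\<close> without \<open>0\<close> occurs. Since \<open>r\<^sup>i q = q r\<^sup>-\<^sup>i\<close>, the
  induced operation on \<open>Z\<close> is \<open>i \<circ> j = \<plusminus>i + j\<close>, with the minus sign exactly for \<open>j \<in> B\<close>
  (\<open>isotopic_nrt_op_twisted_add\<close>).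

  Two such operations, for \<open>B\<close> and \<open>C\<close>, are isotopic if and only if an affine permutation maps \<open>B\<close> to
  \<open>C\<close> or to the complement of \<open>C\<close>. Affine maps give isotopies by direct computation. Conversely, an
  isotopy \<open>(f, g, h)\<close> turns the right translations \<open>R\<^sub>v\<close> of the first operation into those of the second,
  so \<open>h\<close> conjugates \<open>R\<^sub>v \<circ> R\<^sub>w\<^sup>-\<^sup>1\<close> into the corresponding quotient for \<open>g v\<close> and \<open>g w\<close>. This quotient is the
  translation by \<open>v - w\<close> if \<open>v\<close> and \<open>w\<close> lie on the same side of \<open>B\<close>, and the reflection
  \<open>x \<mapsto> v + w - x\<close> otherwise. For odd \<open>n\<close> a reflection has a fixed point and a nontrivial translation has
  none, so \<open>g\<close> respects the two sides. An odd cycle cannot alternate between two sides, so some \<open>v\<close> and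
  \<open>v + 1\<close> lie on the same side; hence \<open>h\<close> conjugates the translation by \<open>1\<close> into a translation and is
  affine. Then \<open>g\<close> is affine on each side, which is enough
  (\<open>isotopic_twisted_add_only_if\<close>).

  It remains to count the orbits of the affine group on all subsets of \<open>Z\<close>, taken up to complement. A
  permutation fixes \<open>2\<^sup>c\<close> subsets when it has \<open>c\<close> cycles, so Burnside's lemma gives
  the cycle index at \<open>2\<close> for the number of orbits (\<open>cycle_index_Aff1_2\<close>). As \<open>n\<close> is odd, of two
  complementary subsets exactly one has fewer than \<open>n / 2\<close> elements, so complementation pairs the
  orbits without fixed points and halves this number (\<open>card_affine_orbits\<close>). An orbit of subsets of
  that smaller size contains one that avoids \<open>0\<close>, as translations show, so every such orbit comes from
  a transversal (\<open>lighter_side_orbits\<close>).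
\<close>

section \<open>The affine group of the integers modulo n\<close>

definition affine_map :: "nat \<Rightarrow> int \<Rightarrow> int \<Rightarrow> int \<Rightarrow> int" where
  "affine_map n \<nu> u y = (if y \<in> {0..<int n} then (\<nu> * y + u) mod int n else y)"

lemma affine_map_in: "n > 0 \<Longrightarrow> y \<in> {0..<int n} \<Longrightarrow> affine_map n \<nu> u y \<in> {0..<int n}"
  by (simp add: affine_map_def)

text \<open>Coefficients that are arbitrary integers, rather than reduced representatives, keep composition
  and inversion free of reductions.\<close>

lemma Aff1_iff:
  assumes "n > 1"
  shows "\<tau> \<in> Aff1 n \<longleftrightarrow> (\<exists>\<nu> u. coprime \<nu> (int n) \<and> \<tau> = affine_map n \<nu> u)"
proof
  interpret residues "int n" "residue_ring (int n)"
    using assms by unfold_locales auto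
  show "\<exists>\<nu> u. coprime \<nu> (int n) \<and> \<tau> = affine_map n \<nu> u" if "\<tau> \<in> Aff1 n"
  proof -
    from that obtain \<nu> u where "\<nu> \<in> Units (residue_ring (int n))"
      and "\<tau> = (\<lambda>y. if y \<in> {0..<int n} then (\<nu> * y + u) mod int n else y)"
      unfolding Aff1_def by blast
    then have "coprime \<nu> (int n)" "\<tau> = affine_map n \<nu> u"
      by (simp_all add: res_units_eq affine_map_def fun_eq_iff)
    then show ?thesis by blast
  qed
  assume "\<exists>\<nu> u. coprime \<nu> (int n) \<and> \<tau> = affine_map n \<nu> u"
  then obtain \<nu> u where cop: "coprime \<nu> (int n)" and \<tau>: "\<tau> = affine_map n \<nu> u"
    by blast
  have "\<nu> mod int n \<noteq> 0"
  proof
    assume "\<nu> mod int n = 0"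
    then have "int n dvd 1"
      using cop by (metis coprime_common_divisor dvd_refl mod_0_imp_dvd)
    with assms show False by simp
  qed
  then have "\<nu> mod int n \<in> Units (residue_ring (int n))"
    using assms cop pos_mod_sign[of "int n" \<nu>] by (simp add: res_units_eq order_less_le[of 0])
  moreover have "u mod int n \<in> carrier (residue_ring (int n))"
    using assms by (simp add: res_carrier_eq)
  moreover have "\<tau> = (\<lambda>y. if y \<in> {0..<int n} then (\<nu> mod int n * y + u mod int n) mod int n else y)"
  proof -
    have "[\<nu> * y + u = \<nu> mod int n * y + u mod int n] (mod int n)" for y
      by (intro cong_add cong_mult) (simp_all add: cong_def)
    then show ?thesis
      unfolding \<tau> affine_map_def cong_def by auto
  qed
  ultimately show "\<tau> \<in> Aff1 n"
    unfolding Aff1_def by blast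
qed

lemma mod_mult_mod_add_eq: "(a * (x mod m) + b) mod m = (a * x + b) mod (m :: int)"
  by (metis mod_add_left_eq mod_mult_right_eq)

lemma affine_map_mod:
  assumes "n > 0"
  shows "affine_map n \<nu> u (x mod int n) = (\<nu> * x + u) mod int n"
  using assms by (simp add: affine_map_def mod_mult_mod_add_eq)

lemma affine_map_comp:
  assumes "n > 0"
  shows "affine_map n \<nu> u \<circ> affine_map n \<nu>' u' = affine_map n (\<nu> * \<nu>') (\<nu> * u' + u)"
proof (rule ext)
  fix y show "(affine_map n \<nu> u \<circ> affine_map n \<nu>' u') y = affine_map n (\<nu> * \<nu>') (\<nu> * u' + u) y"
  proof (cases "y \<in> {0..<int n}")
    case True
    then have "affine_map n \<nu>' u' y = (\<nu>' * y + u') mod int n"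
      by (simp add: affine_map_def)
    then show ?thesis
      using True by (simp add: affine_map_mod[OF assms]) (simp add: affine_map_def algebra_simps)
  qed (auto simp: affine_map_def)
qed

lemma affine_map_id: "[\<nu> = 1] (mod int n) \<Longrightarrow> [u = 0] (mod int n) \<Longrightarrow> affine_map n \<nu> u = id"
proof (rule ext)
  fix y assume *: "[\<nu> = 1] (mod int n)" "[u = 0] (mod int n)"
  then have "[\<nu> * y + u = 1 * y + 0] (mod int n)"
    by (intro cong_add cong_mult) auto
  then show "affine_map n \<nu> u y = id y"
    by (auto simp: affine_map_def cong_def)
qed

lemma Aff1_comp:
  assumes "n > 1" "\<sigma> \<in> Aff1 n" "\<tau> \<in> Aff1 n"
  shows "\<sigma> \<circ> \<tau> \<in> Aff1 n"
proof -
  obtain \<nu> u \<nu>' u' where "coprime \<nu> (int n)" "coprime \<nu>' (int n)"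
    and eq: "\<sigma> = affine_map n \<nu> u" "\<tau> = affine_map n \<nu>' u'"
    using assms Aff1_iff by metis
  then have "coprime (\<nu> * \<nu>') (int n)" by simp
  then show ?thesis
    using assms(1) unfolding eq Aff1_iff[OF assms(1)] by (subst affine_map_comp) (simp, blast)
qed

lemma id_in_Aff1: "n > 1 \<Longrightarrow> id \<in> Aff1 n"
  using affine_map_id[of 1 n 0] Aff1_iff coprime_1_left by (metis cong_refl)

lemma Aff1_inverse:
  assumes "n > 1" "\<tau> \<in> Aff1 n"
  obtains \<sigma> where "\<sigma> \<in> Aff1 n" "\<sigma> \<circ> \<tau> = id" "\<tau> \<circ> \<sigma> = id"
proof -
  obtain \<nu> u where \<nu>: "coprime \<nu> (int n)" and \<tau>: "\<tau> = affine_map n \<nu> u"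
    using assms Aff1_iff by metis
  obtain \<mu> where \<mu>: "[\<nu> * \<mu> = 1] (mod int n)"
    using \<nu> cong_solve_coprime_int by blast
  have "coprime \<mu> (int n)"
    using \<mu> coprime_iff_invertible_int by (metis mult.commute)
  moreover have "[- (\<nu> * \<mu>) * u + u = - 1 * u + u] (mod int n)"
    using \<mu> by (intro cong_add cong_mult cong_minus_minus_iff[THEN iffD2]) auto
  ultimately show thesis
    using assms(1) \<mu>
    by (intro that[of "affine_map n \<mu> (- \<mu> * u)"])
      (auto simp: \<tau> Aff1_iff affine_map_comp mult.commute mult.left_commute intro!: affine_map_id)
qed

lemma Aff1_permutes:
  assumes "n > 1" "\<tau> \<in> Aff1 n"
  shows "\<tau> permutes {0..<int n}"
proof -
  obtain \<sigma> where "\<sigma> \<circ> \<tau> = id" "\<tau> \<circ> \<sigma> = id"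
    using Aff1_inverse[OF assms] .
  then have "bij \<tau>" by (rule o_bij)
  moreover have "\<tau> x = x" if "x \<notin> {0..<int n}" for x
    using assms that by (auto simp: Aff1_iff affine_map_def)
  ultimately show ?thesis
    unfolding permutes_def by (simp add: bij_iff)
qed

lemma finite_Aff1: "n > 1 \<Longrightarrow> finite (Aff1 n)"
proof -
  assume "n > 1"
  then have "Aff1 n \<subseteq> {\<tau>. \<tau> permutes {0..<int n}}"
    using Aff1_permutes by blast
  then show ?thesis
    by (rule finite_subset) (intro finite_permutations, simp)
qed

lemma Aff1_image_subset: "n > 1 \<Longrightarrow> \<tau> \<in> Aff1 n \<Longrightarrow> X \<subseteq> {0..<int n} \<Longrightarrow> \<tau> ` X \<subseteq> {0..<int n}"
  using Aff1_permutes permutes_image by (metis image_mono)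

lemma card_Aff1_image: "n > 1 \<Longrightarrow> \<tau> \<in> Aff1 n \<Longrightarrow> card (\<tau> ` X) = card X"
  by (meson Aff1_permutes card_image permutes_inj_on)

lemma Aff1_image_Diff:
  "n > 1 \<Longrightarrow> \<tau> \<in> Aff1 n \<Longrightarrow> \<tau> ` ({0..<int n} - X) = {0..<int n} - \<tau> ` X"
  by (metis Aff1_permutes image_set_diff permutes_image permutes_inj)

definition affine_orbit :: "nat \<Rightarrow> int set \<Rightarrow> int set set" where
  "affine_orbit n X = {\<tau> ` X | \<tau>. \<tau> \<in> Aff1 n}"

lemma affine_orbit_eq_iff:
  assumes "n > 1"
  shows "affine_orbit n X = affine_orbit n Y \<longleftrightarrow> (\<exists>\<tau>\<in>Aff1 n. Y = \<tau> ` X)"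
proof
  assume "affine_orbit n X = affine_orbit n Y"
  moreover have "Y \<in> affine_orbit n Y"
    unfolding affine_orbit_def using id_in_Aff1[OF assms] by (metis (mono_tags) image_id id_apply mem_Collect_eq)
  ultimately have "Y \<in> affine_orbit n X" by simp
  then show "\<exists>\<tau>\<in>Aff1 n. Y = \<tau> ` X"
    by (auto simp: affine_orbit_def)
next
  assume "\<exists>\<tau>\<in>Aff1 n. Y = \<tau> ` X"
  then obtain \<tau> where \<tau>: "\<tau> \<in> Aff1 n" and Y: "Y = \<tau> ` X" by blast
  obtain \<sigma> where \<sigma>: "\<sigma> \<in> Aff1 n" "\<sigma> \<circ> \<tau> = id"
    using Aff1_inverse[OF assms \<tau>] .
  have X: "X = \<sigma> ` Y"
    using \<sigma>(2) Y by (metis image_comp image_id id_apply)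
  have sub: "affine_orbit n (\<rho> ` V) \<subseteq> affine_orbit n V" if "\<rho> \<in> Aff1 n" for \<rho> V
  proof
    fix W assume "W \<in> affine_orbit n (\<rho> ` V)"
    then obtain \<tau> where "\<tau> \<in> Aff1 n" "W = (\<tau> \<circ> \<rho>) ` V"
      by (auto simp: affine_orbit_def image_comp)
    then show "W \<in> affine_orbit n V"
      using Aff1_comp[OF assms _ that] unfolding affine_orbit_def by blast
  qed
  show "affine_orbit n X = affine_orbit n Y"
    by (intro equalityI sub[OF \<sigma>(1), of Y, folded X] sub[OF \<tau>, of X, folded Y])
qed

section \<open>Counting orbits of subsets\<close>

text \<open>An invariant subset is a union of cycles, and each set of cycles occurs exactly once.\<close>

lemma card_invariant_subsets:
  assumes "\<tau> permutes A" "finite A"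
  shows "card {X \<in> Pow A. \<tau> ` X = X} = 2 ^ card (Orbits.orbit \<tau> ` A)"
proof -
  let ?O = "Orbits.orbit \<tau> ` A"
  have perm: "permutation \<tau>"
    using assms permutation_permutes by blast
  have self: "x \<in> Orbits.orbit \<tau> x" for x
    by (rule permutation_self_in_orbit[OF perm])
  have eq: "Orbits.orbit \<tau> y = Orbits.orbit \<tau> x" if "y \<in> Orbits.orbit \<tau> x" for x y
    using that self by (meson Orbits.orbit_trans orbit_swap subset_antisym subsetI)
  have sub: "Orbits.orbit \<tau> x \<subseteq> A" if "x \<in> A" for x
    using permutes_orbit_subset[OF assms(1) that] .
  have orbit_in: "Orbits.orbit \<tau> x \<subseteq> X" if "\<tau> ` X = X" "x \<in> X" for X x
  proof
    fix y assume "y \<in> Orbits.orbit \<tau> x"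
    then show "y \<in> X" using that by induction auto
  qed
  have "bij_betw Union (Pow ?O) {X \<in> Pow A. \<tau> ` X = X}"
  proof (rule bij_betw_byWitness[where f' = "\<lambda>X. Orbits.orbit \<tau> ` X"])
    show "\<forall>P\<in>Pow ?O. Orbits.orbit \<tau> ` \<Union>P = P"
    proof
      fix P assume P: "P \<in> Pow ?O"
      show "Orbits.orbit \<tau> ` \<Union>P = P"
      proof
        show "Orbits.orbit \<tau> ` \<Union>P \<subseteq> P"
        proof clarify
          fix y C assume "y \<in> C" "C \<in> P"
          moreover from this P obtain x where "C = Orbits.orbit \<tau> x" by blast
          ultimately show "Orbits.orbit \<tau> y \<in> P" using eq by simp
        qed
        show "P \<subseteq> Orbits.orbit \<tau> ` \<Union>P"
        proof
          fix C assume "C \<in> P"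
          moreover from this P obtain x where "C = Orbits.orbit \<tau> x" by blast
          ultimately show "C \<in> Orbits.orbit \<tau> ` \<Union>P" using self[of x] by blast
        qed
      qed
    qed
    show "\<forall>X\<in>{X \<in> Pow A. \<tau> ` X = X}. \<Union> (Orbits.orbit \<tau> ` X) = X"
    proof clarify
      fix X assume "\<tau> ` X = X"
      then show "\<Union> (Orbits.orbit \<tau> ` X) = X"
        using self orbit_in[of X] by (intro equalityI) (simp add: UN_least, blast)
    qed
    show "Union ` Pow ?O \<subseteq> {X \<in> Pow A. \<tau> ` X = X}"
    proof clarify
      fix P assume P: "P \<subseteq> ?O"
      have "\<Union>P \<subseteq> A" using P sub by blast
      moreover have "\<tau> ` \<Union>P \<subseteq> \<Union>P"
      proof clarify
        fix y C assume "y \<in> C" "C \<in> P"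
        moreover from this P obtain x where "C = Orbits.orbit \<tau> x" by blast
        ultimately show "\<tau> y \<in> \<Union>P" using Orbits.orbit.step[of y \<tau> x] by blast
      qed
      moreover have "finite (\<Union>P)"
        using calculation(1) assms(2) finite_subset by blast
      ultimately show "\<Union>P \<in> Pow A \<and> \<tau> ` \<Union>P = \<Union>P"
        using endo_inj_surj permutes_inj_on[OF assms(1)] by blast
    qed
    show "(`) (Orbits.orbit \<tau>) ` {X \<in> Pow A. \<tau> ` X = X} \<subseteq> Pow ?O"
      by blast
  qed
  then have "card {X \<in> Pow A. \<tau> ` X = X} = card (Pow ?O)"
    by (simp add: bij_betw_same_card)
  then show ?thesis
    using assms(2) by (simp add: card_Pow)
qed

text \<open>When all variables of a cycle monomial are equal, only the total number of cycles matters.\<close>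

lemma prod_power_cycle_count:
  fixes c :: "'b :: comm_semiring_1"
  assumes "\<tau> permutes A" "finite A"
  shows "(\<Prod>l = 1..card A. c ^ cycle_count A \<tau> l) = c ^ card (Orbits.orbit \<tau> ` A)"
proof -
  let ?O = "Orbits.orbit \<tau> ` A"
  have perm: "permutation \<tau>"
    using assms permutation_permutes by blast
  have "card C \<in> {1..card A}" if "C \<in> ?O" for C
  proof -
    from that obtain x where x: "x \<in> A" "C = Orbits.orbit \<tau> x" by blast
    then have "C \<subseteq> A" "x \<in> C"
      using permutes_orbit_subset[OF assms(1)] permutation_self_in_orbit[OF perm] by auto
    then show ?thesis
      using assms(2) by (auto simp: card_mono Suc_le_eq card_gt_0_iff intro: finite_subset)
  qed
  then have "(\<Sum>l = 1..card A. \<Sum>C | C \<in> ?O \<and> card C = l. 1) = (\<Sum>C\<in>?O. 1::nat)"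
    using assms(2) by (intro sum.group) auto
  then have "(\<Sum>l = 1..card A. cycle_count A \<tau> l) = card ?O"
    by (simp add: cycle_count_def)
  then show ?thesis
    by (simp add: power_sum[symmetric])
qed

definition composition_monoid :: "('a \<Rightarrow> 'a) set \<Rightarrow> ('a \<Rightarrow> 'a) monoid" where
  "composition_monoid S = \<lparr>carrier = S, monoid.mult = (\<circ>), one = id\<rparr>"

lemma composition_monoid_simps [simp]:
  "carrier (composition_monoid S) = S"
  "\<sigma> \<otimes>\<^bsub>composition_monoid S\<^esub> \<tau> = \<sigma> \<circ> \<tau>"
  "\<one>\<^bsub>composition_monoid S\<^esub> = id"
  by (simp_all add: composition_monoid_def)

lemma group_action_on_subsets:
  assumes "group (composition_monoid S)"
    and perm: "\<And>\<tau>. \<tau> \<in> S \<Longrightarrow> \<tau> permutes A"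
  shows "group_action (composition_monoid S) (Pow A) (\<lambda>\<tau>. restrict ((`) \<tau>) (Pow A))"
proof -
  have "restrict ((`) \<tau>) (Pow A) \<in> Bij (Pow A)" if "\<tau> \<in> S" for \<tau>
    using bij_betw_Pow[OF permutes_imp_bij[OF perm[OF that]]] by (simp add: Bij_def)
  moreover have "restrict ((`) (\<sigma> \<circ> \<tau>)) (Pow A)
      = compose (Pow A) (restrict ((`) \<sigma>) (Pow A)) (restrict ((`) \<tau>) (Pow A))"
    if "\<sigma> \<in> S" "\<tau> \<in> S" for \<sigma> \<tau>
  proof -
    have "\<tau> ` X \<subseteq> A" if "X \<subseteq> A" for X
      using permutes_image[OF perm[OF \<open>\<tau> \<in> S\<close>]] that by blast
    then show ?thesis
      by (auto simp: fun_eq_iff compose_def restrict_def image_comp)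
  qed
  ultimately have "(\<lambda>\<tau>. restrict ((`) \<tau>) (Pow A)) \<in> hom (composition_monoid S) (BijGroup (Pow A))"
    by (intro homI) (simp_all add: BijGroup_def)
  with assms(1) show ?thesis
    by (simp add: group_action_def group_hom_def group_hom_axioms_def group_BijGroup)
qed

text \<open>This is Burnside's lemma for the action of the affine group on subsets: the summand of the cycle
  index that belongs to a permutation is the number of subsets that it fixes.\<close>

lemma cycle_index_Aff1_2:
  assumes "n > 1"
  shows "cycle_index {0..<int n} (Aff1 n) (\<lambda>_. 2) = of_nat (card (affine_orbit n ` Pow {0..<int n}))"
proof -
  let ?Z = "{0..<int n}"
  let ?G = "composition_monoid (Aff1 n)"
  let ?\<phi> = "\<lambda>\<tau>. restrict ((`) \<tau>) (Pow ?Z)"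
  have "group ?G"
  proof (rule groupI)
    fix \<tau> assume "\<tau> \<in> carrier ?G"
    then show "\<exists>\<sigma>\<in>carrier ?G. \<sigma> \<otimes>\<^bsub>?G\<^esub> \<tau> = \<one>\<^bsub>?G\<^esub>"
      using Aff1_inverse[OF assms] by (metis composition_monoid_simps)
  qed (use assms in \<open>auto simp: Aff1_comp id_in_Aff1 comp_assoc\<close>)
  then interpret group_action ?G "Pow ?Z" ?\<phi>
    by (rule group_action_on_subsets) (rule Aff1_permutes[OF assms])
  have "orbits ?G (Pow ?Z) ?\<phi> = affine_orbit n ` Pow ?Z"
    by (auto simp: orbits_def Group_Action.orbit_def affine_orbit_def image_def)
  moreover have "invariants (Pow ?Z) ?\<phi> \<tau> = {X \<in> Pow ?Z. \<tau> ` X = X}" for \<tau>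
    by (auto simp: invariants_def)
  ultimately have "card (affine_orbit n ` Pow ?Z) * card (Aff1 n)
      = (\<Sum>\<tau>\<in>Aff1 n. card {X \<in> Pow ?Z. \<tau> ` X = X})"
    using burnside finite_Aff1[OF assms] by (simp add: order_def)
  also have "\<dots> = (\<Sum>\<tau>\<in>Aff1 n. \<Prod>l = 1..card ?Z. 2 ^ cycle_count ?Z \<tau> l)"
    using Aff1_permutes[OF assms]
    by (intro sum.cong) (simp_all only: card_invariant_subsets prod_power_cycle_count
        finite_atLeastLessThan_int)
  finally have "(\<Sum>\<tau>\<in>Aff1 n. \<Prod>l = 1..card ?Z. 2 ^ cycle_count ?Z \<tau> l)
      = (of_nat (card (affine_orbit n ` Pow ?Z) * card (Aff1 n)) :: rat)"
    by simp
  moreover have "card (Aff1 n) \<noteq> 0"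
    using finite_Aff1[OF assms] id_in_Aff1[OF assms] by auto
  ultimately show ?thesis
    unfolding cycle_index_def by simp
qed

definition light_affine_orbits :: "nat \<Rightarrow> int set set set" where
  "light_affine_orbits n = affine_orbit n ` {X. X \<subseteq> {0..<int n} \<and> 2 * card X < n}"

text \<open>Complementation commutes with permutations, so it maps orbits to orbits. It exchanges the orbits
  of sets with fewer than \<open>n / 2\<close> elements with those of sets with more; for odd \<open>n\<close> there are no
  others.\<close>

lemma card_affine_orbits:
  assumes "odd n" "n > 1"
  shows "card (affine_orbit n ` Pow {0..<int n}) = 2 * card (light_affine_orbits n)"
proof -
  let ?Z = "{0..<int n}"
  let ?c = "\<lambda>X. ?Z - X"
  let ?heavy = "affine_orbit n ` {X. X \<subseteq> ?Z \<and> n < 2 * card X}"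
  have compl: "affine_orbit n (?c X) = ?c ` affine_orbit n X" for X
  proof -
    have image: "affine_orbit n Y = (\<lambda>\<tau>. \<tau> ` Y) ` Aff1 n" for Y
      unfolding affine_orbit_def by blast
    show ?thesis
      unfolding image image_image by (rule image_cong[OF refl]) (erule Aff1_image_Diff[OF assms(2)])
  qed
  have card_compl: "card (?c X) = n - card X" "card X \<le> n" if "X \<subseteq> ?Z" for X
    using that card_mono[OF _ that] by (simp_all add: card_Diff_subset finite_subset[OF that])
  have heavy: "?heavy = (`) ?c ` light_affine_orbits n"
  proof -
    have *: "{X. X \<subseteq> ?Z \<and> n < 2 * card X} = ?c ` {X. X \<subseteq> ?Z \<and> 2 * card X < n}"
    proof (intro equalityI subsetI)
      fix X assume X: "X \<in> {X. X \<subseteq> ?Z \<and> n < 2 * card X}"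
      then have "X = ?c (?c X)" "2 * card (?c X) < n"
        using card_compl[of X] by (auto simp: double_diff)
      then show "X \<in> ?c ` {X. X \<subseteq> ?Z \<and> 2 * card X < n}" by blast
    next
      fix X assume "X \<in> ?c ` {X. X \<subseteq> ?Z \<and> 2 * card X < n}"
      then show "X \<in> {X. X \<subseteq> ?Z \<and> n < 2 * card X}"
        using card_compl by auto
    qed
    show ?thesis
      unfolding * light_affine_orbits_def by (simp add: image_image compl)
  qed
  have split: "affine_orbit n ` Pow ?Z = light_affine_orbits n \<union> ?heavy"
  proof -
    have "2 * card X \<noteq> n" for X :: "int set" using assms(1) by auto
    then have "Pow ?Z = {X. X \<subseteq> ?Z \<and> 2 * card X < n} \<union> {X. X \<subseteq> ?Z \<and> n < 2 * card X}"
      by (auto simp: linorder_neq_iff)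
    then show ?thesis
      unfolding light_affine_orbits_def by (simp only: image_Un)
  qed
  have disjoint: "light_affine_orbits n \<inter> ?heavy = {}"
    unfolding light_affine_orbits_def
    by (auto simp: affine_orbit_eq_iff[OF assms(2)] card_Aff1_image[OF assms(2)])
  have fin: "finite (light_affine_orbits n)"
    unfolding light_affine_orbits_def by (rule finite_imageI, rule finite_subset[of _ "Pow ?Z"]) auto
  have "inj_on ((`) ?c) (light_affine_orbits n)"
  proof (rule inj_on_inverseI[where g = "(`) ?c"])
    fix K assume "K \<in> light_affine_orbits n"
    then obtain X where "X \<subseteq> ?Z" "K = affine_orbit n X" by (auto simp: light_affine_orbits_def)
    then show "?c ` ?c ` K = K"
      by (simp add: compl[symmetric] double_diff)
  qed
  then have card: "card ?heavy = card (light_affine_orbits n)"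
    unfolding heavy by (rule card_image)
  have "finite ?heavy"
    unfolding heavy using fin by (rule finite_imageI)
  from card_Un_disjoint[OF fin this disjoint] show ?thesis
    unfolding split card by (simp only: mult_2)
qed

section \<open>Isotopy of the twisted additions\<close>

text \<open>When \<open>0 \<notin> B\<close>, this is the right loop of the transversal that represents the cosets in \<open>B\<close> by
  elements \<open>q r\<^sup>i\<close> and the others by \<open>r\<^sup>i\<close>, transported to the integers modulo \<open>n\<close>.\<close>

definition twisted_add :: "nat \<Rightarrow> int set \<Rightarrow> int \<Rightarrow> int \<Rightarrow> int" where
  "twisted_add n B i j = ((if j \<in> B then - 1 else 1) * i + j) mod int n"

text \<open>If \<open>\<tau>\<close> is \<open>y \<mapsto> \<nu> y + u\<close>, then \<open>g = h = \<tau>\<close> and \<open>f = \<plusminus>\<nu>\<close> form an isotopy. The sign is that of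
  \<open>C = \<tau> ` B\<close> versus its complement: passing to the complement negates the left argument
  throughout.\<close>

lemma isotopic_twisted_add_if:
  assumes "n > 1" and \<tau>: "\<tau> \<in> Aff1 n" and B: "B \<subseteq> {0..<int n}"
    and C: "C = \<tau> ` B \<or> C = {0..<int n} - \<tau> ` B"
  shows "isotopic {0..<int n} (twisted_add n B) {0..<int n} (twisted_add n C)"
proof -
  let ?Z = "{0..<int n}"
  obtain \<nu> u where \<nu>: "coprime \<nu> (int n)" and \<tau>_eq: "\<tau> = affine_map n \<nu> u"
    using assms Aff1_iff by metis
  define e :: int where "e = (if C = \<tau> ` B then 1 else - 1)"
  let ?f = "affine_map n (e * \<nu>) 0"
  have "?f \<in> Aff1 n"
  proof -
    have "coprime (e * \<nu>) (int n)" using \<nu> by (simp add: e_def)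
    then show ?thesis using assms(1) Aff1_iff by blast
  qed
  then have "bij_betw ?f ?Z ?Z" "bij_betw \<tau> ?Z ?Z"
    using Aff1_permutes[OF assms(1)] \<tau> permutes_imp_bij by blast+
  moreover have "twisted_add n C (?f i) (\<tau> j) = \<tau> (twisted_add n B i j)" if "i \<in> ?Z" "j \<in> ?Z" for i j
  proof -
    have inj: "inj \<tau>" using Aff1_permutes[OF assms(1) \<tau>] permutes_inj by blast
    have "\<tau> j \<in> ?Z" using that assms(1) unfolding \<tau>_eq by (intro affine_map_in) simp_all
    then have "(if \<tau> j \<in> C then - 1 else 1) * e = (if j \<in> B then - 1 else 1)"
      using C inj_image_mem_iff[OF inj, of j B] by (cases "C = \<tau> ` B") (simp_all add: e_def)
    then have sign: "(if \<tau> j \<in> C then - 1 else 1) * (e * \<nu> * i) = (if j \<in> B then - 1 else 1) * (\<nu> * i)"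
      by (simp only: mult.assoc[symmetric])
    have "twisted_add n C (?f i) (\<tau> j)
        = ((if \<tau> j \<in> C then - 1 else 1) * (e * \<nu> * i) + (\<nu> * j + u)) mod int n"
      using that by (simp add: twisted_add_def \<tau>_eq affine_map_def mod_mult_mod_add_eq mod_simps)
    also have "\<dots> = (\<nu> * ((if j \<in> B then - 1 else 1) * i + j) + u) mod int n"
      unfolding sign by (simp add: algebra_simps)
    also have "\<dots> = \<tau> (twisted_add n B i j)"
      using assms(1) by (simp add: twisted_add_def \<tau>_eq affine_map_mod)
    finally show ?thesis .
  qed
  ultimately show ?thesis
    unfolding isotopic_def by blast
qed

lemma exists_half:
  assumes "odd n"
  obtains x where "x \<in> {0..<int n}" "[2 * x = s] (mod int n)"
proof -
  have "2 * ((int n + 1) div 2) = int n + 1"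
    using assms by (intro dvd_mult_div_cancel) simp
  then have "2 * (s * ((int n + 1) div 2)) = s * int n + s"
    by (metis distrib_left mult.left_commute mult.right_neutral)
  moreover have "[2 * ((s * ((int n + 1) div 2)) mod int n) = 2 * (s * ((int n + 1) div 2))] (mod int n)"
    by (simp add: cong_def mod_simps)
  ultimately have "[2 * ((s * ((int n + 1) div 2)) mod int n) = s] (mod int n)"
    by (simp add: cong_def)
  moreover have "n > 0" using assms by (cases n) auto
  ultimately show thesis by (intro that[of "(s * ((int n + 1) div 2)) mod int n"]) auto
qed

text \<open>Otherwise membership in \<open>B\<close> would alternate around a cycle of odd length.\<close>

lemma exists_consecutive_same_side:
  assumes "odd n"
  obtains v where "v \<in> {0..<int n}" "v \<in> B \<longleftrightarrow> (v + 1) mod int n \<in> B"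
proof (rule ccontr)
  assume "\<not> thesis"
  with that have alt: "v \<in> B \<longleftrightarrow> (v + 1) mod int n \<notin> B" if "v \<in> {0..<int n}" for v
    using \<open>v \<in> {0..<int n}\<close> by blast
  have "int k \<in> B \<longleftrightarrow> (0 \<in> B \<longleftrightarrow> even k)" if "k < n" for k
    using that
  proof (induction k)
    case (Suc k)
    then have "int k \<in> B \<longleftrightarrow> int (Suc k) \<notin> B"
      using alt[of "int k"] by (simp add: add.commute)
    with Suc show ?case by auto
  qed simp
  from this[of "n - 1"] have "int (n - 1) \<in> B \<longleftrightarrow> 0 \<in> B"
    using assms by (cases n) auto
  moreover have "int (n - 1) \<in> B \<longleftrightarrow> 0 \<notin> B"
    using alt[of "int (n - 1)"] assms by (cases n) (auto simp: add.commute)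
  ultimately show False by blast
qed

text \<open>The right translations of an isotope are \<open>h \<circ> R\<^sub>v \<circ> f\<^sup>-\<^sup>1\<close>, so the quotients \<open>R\<^sub>v \<circ> R\<^sub>w\<^sup>-\<^sup>1\<close> are
  conjugated by \<open>h\<close> alone. The proof reads off from these translations and reflections first how
  \<open>g\<close> treats the two sides, then that \<open>h\<close> is affine, and finally that \<open>g\<close> is affine on each side with
  the same linear coefficient as \<open>h\<close>. The constant terms on the two sides may differ, so \<open>g\<close> itself
  need not be affine; only its values on \<open>B\<close> are used.\<close>

lemma isotopic_twisted_add_only_if:
  assumes "odd n" "n > 1" and B: "B \<subseteq> {0..<int n}" and C: "C \<subseteq> {0..<int n}"
    and iso: "isotopic {0..<int n} (twisted_add n B) {0..<int n} (twisted_add n C)"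
  shows "\<exists>\<tau>\<in>Aff1 n. C = \<tau> ` B \<or> C = {0..<int n} - \<tau> ` B"
proof -
  let ?N = "int n" and ?Z = "{0..<int n}"
  obtain f g h where bij: "bij_betw f ?Z ?Z" "bij_betw g ?Z ?Z" "bij_betw h ?Z ?Z"
    and iso: "\<And>u v. u \<in> ?Z \<Longrightarrow> v \<in> ?Z \<Longrightarrow> twisted_add n C (f u) (g v) = h (twisted_add n B u v)"
    using iso unfolding isotopic_def by blast
  have N: "?N > 0" using assms(2) by simp
  have g_in: "g v \<in> ?Z" and h_in: "h v \<in> ?Z" if "v \<in> ?Z" for v
    using bij that by (auto dest: bij_betwE)
  have Z_eq: "x = y" if "[x = y] (mod ?N)" "x \<in> ?Z" "y \<in> ?Z" for x y
    using that by (simp add: cong_def)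
  define s where "s X v = (if v \<in> X then - 1 else 1 :: int)" for X :: "int set" and v
  have s_sq: "s X v * s X v = 1" for X v by (simp add: s_def)
  \<comment> \<open>\<open>R\<^sub>v \<circ> R\<^sub>w\<^sup>-\<^sup>1\<close> is the map \<open>x \<mapsto> s B v * s B w * (x - w) + v\<close>, and the point \<open>u\<close> below is
    the preimage of \<open>x\<close> under \<open>R\<^sub>w\<close>.\<close>
  have conj: "[h ((s B v * s B w * (x - w) + v) mod ?N) = s C (g v) * s C (g w) * (h x - g w) + g v] (mod ?N)"
    if "v \<in> ?Z" "w \<in> ?Z" "x \<in> ?Z" for v w x
  proof -
    define u where "u = (s B w * (x - w)) mod ?N"
    have u: "u \<in> ?Z" using N by (simp add: u_def)
    have "twisted_add n B u w = (s B w * s B w * (x - w) + w) mod ?N"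
      by (simp add: twisted_add_def u_def s_def[symmetric] mod_mult_mod_add_eq mult.assoc)
    also have "\<dots> = x" using that by (simp add: s_sq)
    finally have "h x = (s C (g w) * f u + g w) mod ?N"
      using iso[OF u that(2)] by (simp add: twisted_add_def s_def)
    then have "[s C (g w) * (h x - g w) = s C (g w) * (s C (g w) * f u + g w - g w)] (mod ?N)"
      by (intro cong_mult cong_diff) (simp_all add: cong_def)
    then have "[s C (g w) * (h x - g w) = f u] (mod ?N)"
      by (simp add: mult.assoc[symmetric] s_sq)
    then have "[s C (g v) * (s C (g w) * (h x - g w)) + g v = s C (g v) * f u + g v] (mod ?N)"
      by (intro cong_add cong_mult) simp_all
    also have "[s C (g v) * f u + g v = h (twisted_add n B u v)] (mod ?N)"
      unfolding iso[OF u that(1), symmetric] by (simp add: twisted_add_def s_def cong_def)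
    also have "twisted_add n B u v = (s B v * s B w * (x - w) + v) mod ?N"
      by (simp add: twisted_add_def u_def s_def[symmetric] mod_mult_mod_add_eq mult.assoc)
    finally show ?thesis by (simp add: cong_sym mult.assoc)
  qed
  have same: "(v \<in> B \<longleftrightarrow> w \<in> B) \<longleftrightarrow> (g v \<in> C \<longleftrightarrow> g w \<in> C)" if vw: "v \<in> ?Z" "w \<in> ?Z" for v w
  proof (rule ccontr)
    assume contr: "\<not> ?thesis"
    then consider (trans) "v \<in> B \<longleftrightarrow> w \<in> B" "\<not> (g v \<in> C \<longleftrightarrow> g w \<in> C)"
      | (refl) "\<not> (v \<in> B \<longleftrightarrow> w \<in> B)" "g v \<in> C \<longleftrightarrow> g w \<in> C" by blast
    then have "v = w"
    proof cases
      case trans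
      \<comment> \<open>\<open>h\<close> would conjugate a translation into a reflection, and \<open>y\<close> is the fixed point of the latter.\<close>
      obtain y where y: "y \<in> ?Z" "[2 * y = g v + g w] (mod ?N)"
        using exists_half[OF assms(1)] .
      obtain x where x: "x \<in> ?Z" "h x = y"
        using bij(3) y(1) by (metis bij_betw_imp_surj_on imageE)
      have "s B v * s B w = 1" "s C (g v) * s C (g w) = - 1" using trans by (auto simp: s_def)
      with conj[OF vw x(1)] have "[h ((x - w + v) mod ?N) = - (y - g w) + g v] (mod ?N)"
        by (simp add: x)
      also have "- (y - g w) + g v = (g v + g w) - y" by simp
      also have "[g v + g w - y = 2 * y - y] (mod ?N)"
        using y(2) by (intro cong_diff) (auto simp: cong_sym)
      finally have "h ((x - w + v) mod ?N) = h x"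
        using h_in[of "(x - w + v) mod ?N"] N h_in[OF x(1)] x(2) by (intro Z_eq) simp_all
      then have "(x - w + v) mod ?N = x"
        by (rule inj_onD[OF bij_betw_imp_inj_on[OF bij(3)]]) (use x(1) N in simp_all)
      then have "[x - w + v = x] (mod ?N)"
        using x by (simp add: cong_def)
      then have "[x - w + v - (x - w) = x - (x - w)] (mod ?N)"
        by (intro cong_diff) simp_all
      then show ?thesis using vw by (intro Z_eq) simp_all
    next
      case refl
      \<comment> \<open>\<open>h\<close> would conjugate a reflection, with fixed point \<open>x\<close>, into a translation.\<close>
      obtain x where x: "x \<in> ?Z" "[2 * x = v + w] (mod ?N)"
        using exists_half[OF assms(1)] .
      have sg: "s B v * s B w = - 1" "s C (g v) * s C (g w) = 1" using refl by (auto simp: s_def)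
      have "[v + w - x = 2 * x - x] (mod ?N)"
        using x(2) by (intro cong_diff) (auto simp: cong_sym)
      then have "(v + w - x) mod ?N = x"
        using x by (simp add: cong_def)
      with conj[OF vw x(1)] sg have "[h x = h x - g w + g v] (mod ?N)"
        by (simp add: algebra_simps)
      then have "[h x - (h x - g w) = h x - g w + g v - (h x - g w)] (mod ?N)"
        by (intro cong_diff) simp_all
      then have "g v = g w" using vw g_in by (intro Z_eq cong_sym[of "g w"]) simp_all
      then show ?thesis
        by (rule inj_onD[OF bij_betw_imp_inj_on[OF bij(2)]]) (use vw in simp_all)
    qed
    with contr show False by simp
  qed
  have shift: "[h ((x - w + v) mod ?N) = h x - g w + g v] (mod ?N)"
    if "v \<in> ?Z" "w \<in> ?Z" "x \<in> ?Z" "v \<in> B \<longleftrightarrow> w \<in> B" for v w x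
  proof -
    have "s B v * s B w = 1" "s C (g v) * s C (g w) = 1"
      using that same[OF that(1,2)] by (auto simp: s_def)
    with conj[OF that(1-3)] show ?thesis by simp
  qed
  obtain v0 where v0: "v0 \<in> ?Z" "v0 \<in> B \<longleftrightarrow> (v0 + 1) mod ?N \<in> B"
    using exists_consecutive_same_side[OF assms(1)] .
  define e where "e = g ((v0 + 1) mod ?N) - g v0"
  have step: "[h ((x + 1) mod ?N) = h x + e] (mod ?N)" if "x \<in> ?Z" for x
  proof -
    have "(x - v0 + (v0 + 1) mod ?N) mod ?N = (x + 1) mod ?N"
      by (simp add: mod_simps)
    then show ?thesis
      using shift[of "(v0 + 1) mod ?N" v0 x] v0 that N by (simp add: e_def algebra_simps)
  qed
  have "[h (int k) = h 0 + e * int k] (mod ?N)" if "k < n" for k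
    using that
  proof (induction k)
    case (Suc k)
    then have "[h (int (Suc k)) = h (int k) + e] (mod ?N)"
      using step[of "int k"] by (simp add: add.commute)
    also have "[h (int k) + e = h 0 + e * int k + e] (mod ?N)"
      using Suc by (intro cong_add) simp_all
    finally show ?case by (simp add: algebra_simps)
  qed simp
  then have affine: "[h x = h 0 + e * x] (mod ?N)" if "x \<in> ?Z" for x
    using that by (metis atLeastLessThan_iff int_nat_eq nat_less_iff)
  \<comment> \<open>Surjectivity of \<open>h\<close> provides an inverse of the linear coefficient.\<close>
  have "coprime e ?N"
  proof -
    have "(h 0 + 1) mod ?N \<in> h ` ?Z"
      using bij(3) N by (simp add: bij_betw_def)
    then obtain x where x: "x \<in> ?Z" "h x = (h 0 + 1) mod ?N" by auto
    then have "[h 0 + 1 = h 0 + e * x] (mod ?N)"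
      using affine[OF x(1)] by (simp add: cong_def)
    then have "[e * x = 1] (mod ?N)"
      by (simp add: cong_add_lcancel cong_sym)
    then show ?thesis using coprime_iff_invertible_int by blast
  qed
  have g_diff: "[g v = e * v + (g w - e * w)] (mod ?N)"
    if "v \<in> ?Z" "w \<in> ?Z" "v \<in> B \<longleftrightarrow> w \<in> B" for v w
  proof -
    have "[h 0 + e * (v - w) = h 0 + e * ((0 - w + v) mod ?N)] (mod ?N)"
      by (intro cong_add cong_mult cong_refl) (simp add: cong_def)
    also have "[h 0 + e * ((0 - w + v) mod ?N) = h ((0 - w + v) mod ?N)] (mod ?N)"
      using N by (intro cong_sym[OF affine]) simp
    also have "[h ((0 - w + v) mod ?N) = h 0 - g w + g v] (mod ?N)"
      using N by (intro shift that) simp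
    finally have "[h 0 + e * (v - w) + (g w - h 0) = h 0 - g w + g v + (g w - h 0)] (mod ?N)"
      by (rule cong_add) (rule cong_refl)
    then show ?thesis by (simp add: algebra_simps cong_sym)
  qed
  obtain a where a: "g v = affine_map n e a v" if "v \<in> B" for v
  proof (cases "B = {}")
    case False
    then obtain w where w: "w \<in> B" by blast
    show thesis
    proof (rule that)
      fix v assume "v \<in> B"
      then show "g v = affine_map n e (g w - e * w) v"
        using g_diff[of v w] w B g_in[of v] by (auto simp: affine_map_def cong_def)
    qed
  qed (use that in blast)
  have "affine_map n e a \<in> Aff1 n"
    using \<open>coprime e ?N\<close> assms(2) by (auto simp: Aff1_iff)
  moreover have "g ` B = affine_map n e a ` B" using a by simp
  moreover have "C = g ` B \<or> C = ?Z - g ` B"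
  proof -
    have g: "g ` ?Z = ?Z" "inj_on g ?Z" using bij(2) by (auto simp: bij_betw_def)
    have zero: "0 \<in> ?Z" using N by simp
    have "(\<forall>v\<in>?Z. g v \<in> C \<longleftrightarrow> v \<in> B) \<or> (\<forall>v\<in>?Z. g v \<in> C \<longleftrightarrow> v \<notin> B)"
      using same[OF _ zero] by blast
    moreover have "g v \<in> g ` B \<longleftrightarrow> v \<in> B" if "v \<in> ?Z" for v
      using inj_on_image_mem_iff[OF g(2) that B] .
    ultimately have "(\<forall>y\<in>?Z. y \<in> C \<longleftrightarrow> y \<in> g ` B) \<or> (\<forall>y\<in>?Z. y \<in> C \<longleftrightarrow> y \<notin> g ` B)"
      by (metis g(1) imageE)
    moreover have "g ` B \<subseteq> ?Z" using B g(1) by blast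
    ultimately show ?thesis using C by blast
  qed
  ultimately show ?thesis by metis
qed

text \<open>For odd \<open>n\<close>, a choice of one set from each complementary pair, which turns equality up to complement into
  equality. Choosing by size makes it commute with permutations.\<close>

definition lighter_side :: "nat \<Rightarrow> int set \<Rightarrow> int set" where
  "lighter_side n B = (if 2 * card B < n then B else {0..<int n} - B)"

lemma isotopic_twisted_add_iff:
  assumes "odd n" "n > 1" and B: "B \<subseteq> {0..<int n}" and C: "C \<subseteq> {0..<int n}"
  shows "isotopic {0..<int n} (twisted_add n B) {0..<int n} (twisted_add n C) \<longleftrightarrow>
    affine_orbit n (lighter_side n B) = affine_orbit n (lighter_side n C)"
proof -
  let ?Z = "{0..<int n}"
  have iff: "isotopic ?Z (twisted_add n B) ?Z (twisted_add n C) \<longleftrightarrow>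
      (\<exists>\<tau>\<in>Aff1 n. C = \<tau> ` B \<or> C = ?Z - \<tau> ` B)"
  proof
    assume "\<exists>\<tau>\<in>Aff1 n. C = \<tau> ` B \<or> C = ?Z - \<tau> ` B"
    then show "isotopic ?Z (twisted_add n B) ?Z (twisted_add n C)"
      by (elim bexE) (rule isotopic_twisted_add_if[OF assms(2) _ B])
  qed (rule isotopic_twisted_add_only_if[OF assms])
  have "C = \<tau> ` B \<or> C = ?Z - \<tau> ` B \<longleftrightarrow> lighter_side n C = \<tau> ` lighter_side n B"
    if \<tau>: "\<tau> \<in> Aff1 n" for \<tau>
  proof -
    have sub: "\<tau> ` B \<subseteq> ?Z" using Aff1_image_subset[OF assms(2) \<tau> B] .
    have cards: "card (\<tau> ` B) = card B" "card (?Z - \<tau> ` B) = n - card B" "card B \<le> n"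
      using card_Aff1_image[OF assms(2) \<tau>] sub B card_mono[OF _ B]
      by (auto simp: card_Diff_subset finite_subset)
    have odd: "2 * card B \<noteq> n" using assms(1) by auto
    have eq: "\<tau> ` lighter_side n B = (if 2 * card B < n then \<tau> ` B else ?Z - \<tau> ` B)"
      using Aff1_image_Diff[OF assms(2) \<tau>] by (simp add: lighter_side_def)
    show ?thesis
    proof
      assume "C = \<tau> ` B \<or> C = ?Z - \<tau> ` B"
      then show "lighter_side n C = \<tau> ` lighter_side n B"
      proof
        assume "C = \<tau> ` B"
        then show ?thesis unfolding eq using cards by (simp add: lighter_side_def)
      next
        assume C_eq: "C = ?Z - \<tau> ` B"
        then have "2 * card C < n \<longleftrightarrow> \<not> 2 * card B < n" using cards odd by auto
        then show ?thesis unfolding eq using sub C_eq by (auto simp: lighter_side_def)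
      qed
    next
      assume "lighter_side n C = \<tau> ` lighter_side n B"
      then show "C = \<tau> ` B \<or> C = ?Z - \<tau> ` B"
        unfolding eq using sub C by (auto simp: lighter_side_def split: if_splits)
    qed
  qed
  then show ?thesis
    unfolding iff affine_orbit_eq_iff[OF assms(2)] by (rule bex_cong[OF refl])
qed

text \<open>The sets without \<open>0\<close> reach every orbit of small sets: a set \<open>X\<close> with fewer than \<open>n / 2\<close> elements
  misses some \<open>z\<close>, and translating by \<open>- z\<close> moves this gap to \<open>0\<close>.\<close>

lemma lighter_side_orbits:
  assumes "odd n" "n > 1"
  shows "(\<lambda>B. affine_orbit n (lighter_side n B)) ` {B. B \<subseteq> {0..<int n} \<and> 0 \<notin> B} = light_affine_orbits n"
proof (intro equalityI subsetI)
  let ?Z = "{0..<int n}"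
  fix K assume "K \<in> (\<lambda>B. affine_orbit n (lighter_side n B)) ` {B. B \<subseteq> ?Z \<and> 0 \<notin> B}"
  then obtain B where B: "B \<subseteq> ?Z" and K: "K = affine_orbit n (lighter_side n B)" by blast
  have "2 * card B \<noteq> n" using assms(1) by auto
  then have "2 * card (lighter_side n B) < n" "lighter_side n B \<subseteq> ?Z"
    using B card_mono[OF _ B] by (auto simp: lighter_side_def card_Diff_subset finite_subset)
  then show "K \<in> light_affine_orbits n"
    unfolding K light_affine_orbits_def by blast
next
  let ?Z = "{0..<int n}"
  fix K assume "K \<in> light_affine_orbits n"
  then obtain X where X: "X \<subseteq> ?Z" "2 * card X < n" and K: "K = affine_orbit n X"
    by (auto simp: light_affine_orbits_def)
  have "X \<noteq> ?Z" using X(2) by auto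
  with X(1) obtain z where z: "z \<in> ?Z" "z \<notin> X" by blast
  define \<tau> where "\<tau> = affine_map n 1 (- z)"
  have \<tau>: "\<tau> \<in> Aff1 n" unfolding \<tau>_def Aff1_iff[OF assms(2)] using coprime_1_left by blast
  have "\<tau> z = 0" using z by (simp add: \<tau>_def affine_map_def)
  then have "0 \<notin> \<tau> ` X"
    using z permutes_inj[OF Aff1_permutes[OF assms(2) \<tau>]] by (metis inj_image_mem_iff)
  moreover have "lighter_side n (\<tau> ` X) = \<tau> ` X"
    using X(2) card_Aff1_image[OF assms(2) \<tau>] by (simp add: lighter_side_def)
  moreover have "\<tau> ` X \<subseteq> ?Z" using Aff1_image_subset[OF assms(2) \<tau> X(1)] .
  moreover have "K = affine_orbit n (\<tau> ` X)"
    unfolding K by (rule affine_orbit_eq_iff[OF assms(2), THEN iffD2, OF bexI[OF refl \<tau>]])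
  ultimately show "K \<in> (\<lambda>B. affine_orbit n (lighter_side n B)) ` {B. B \<subseteq> ?Z \<and> 0 \<notin> B}"
    by (intro image_eqI[of _ _ "\<tau> ` X"]) auto
qed

section \<open>Transversals as twisted additions\<close>

text \<open>The coordinates of \<open>x = q\<^sup>s r\<^sup>i\<close> are \<open>\<kappa> x = i\<close> and \<open>\<sigma> x = (s = 1)\<close>, where \<open>q\<close> generates \<open>H\<close>. Putting the
  reflection on the left makes \<open>\<kappa>\<close> an index of the right cosets of \<open>H\<close>.\<close>

locale dihedral_coordinates = group G for G :: "('a, 'b) monoid_scheme" (structure) +
  fixes H :: "'a set" and n :: nat and \<kappa> :: "'a \<Rightarrow> int" and \<sigma> :: "'a \<Rightarrow> bool"
  assumes n_gt_1: "n > 1"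
    and coordinates: "bij_betw (\<lambda>x. (\<kappa> x, \<sigma> x)) (carrier G) ({0..<int n} \<times> UNIV)"
    and \<kappa>_mult: "x \<in> carrier G \<Longrightarrow> y \<in> carrier G \<Longrightarrow>
      \<kappa> (x \<otimes> y) = ((if \<sigma> y then - 1 else 1) * \<kappa> x + \<kappa> y) mod int n"
    and \<sigma>_one: "\<not> \<sigma> \<one>"
    and H_eq: "H = {x \<in> carrier G. \<kappa> x = 0}"
begin

lemma \<kappa>_in: "x \<in> carrier G \<Longrightarrow> \<kappa> x \<in> {0..<int n}"
  using coordinates by (auto dest: bij_betwE)

lemma \<kappa>_one: "\<kappa> \<one> = 0"
proof -
  have "[\<kappa> \<one> + 0 = \<kappa> \<one> + \<kappa> \<one>] (mod int n)"
    using \<kappa>_mult[of \<one> \<one>] \<sigma>_one \<kappa>_in[of \<one>] by (simp add: cong_def)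
  then show ?thesis
    using \<kappa>_in[of \<one>] unfolding cong_add_lcancel by (simp add: cong_def)
qed

lemma r_coset_eq:
  assumes x: "x \<in> carrier G"
  shows "H #> x = {y \<in> carrier G. \<kappa> y = \<kappa> x}"
proof (intro equalityI subsetI)
  fix y assume "y \<in> H #> x"
  then show "y \<in> {y \<in> carrier G. \<kappa> y = \<kappa> x}"
    using x \<kappa>_in[OF x] by (auto simp: r_coset_def H_eq \<kappa>_mult)
next
  fix y assume y: "y \<in> {y \<in> carrier G. \<kappa> y = \<kappa> x}"
  define z where "z = y \<otimes> inv x"
  have z: "z \<in> carrier G" "y = z \<otimes> x" using x y by (auto simp: z_def m_assoc)
  define s where "s = (if \<sigma> x then - 1 else 1 :: int)"
  have "\<kappa> x = (s * \<kappa> z + \<kappa> x) mod int n"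
    using \<kappa>_mult[OF z(1) x] y z(2) by (simp add: s_def)
  then have "[s * \<kappa> z + \<kappa> x = 0 + \<kappa> x] (mod int n)"
    using \<kappa>_in[OF x] by (simp add: cong_def)
  then have "[s * (s * \<kappa> z) = s * 0] (mod int n)"
    unfolding cong_add_rcancel by (intro cong_mult) simp_all
  then have "\<kappa> z = 0"
    using \<kappa>_in[OF z(1)] by (simp add: s_def cong_def split: if_splits)
  then show "y \<in> H #> x"
    using z by (auto simp: r_coset_def H_eq)
qed

lemma NRT_iff:
  "T \<in> NRT G H \<longleftrightarrow> T \<subseteq> carrier G \<and> \<one> \<in> T \<and> bij_betw \<kappa> T {0..<int n}"
proof (cases "T \<subseteq> carrier G")
  case True
  have "rcosets H = (\<lambda>i. {y \<in> carrier G. \<kappa> y = i}) ` \<kappa> ` carrier G"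
    by (auto simp: RCOSETS_def r_coset_eq)
  also have "\<kappa> ` carrier G = fst ` (\<lambda>x. (\<kappa> x, \<sigma> x)) ` carrier G"
    by (simp add: image_image)
  also have "\<dots> = {0..<int n}"
    using coordinates by (simp add: bij_betw_def)
  finally have rcosets: "rcosets H = (\<lambda>i. {y \<in> carrier G. \<kappa> y = i}) ` {0..<int n}" .
  have "t \<in> {y \<in> carrier G. \<kappa> y = i} \<inter> T \<longleftrightarrow> t \<in> T \<and> \<kappa> t = i" for t i
    using True by blast
  then have "(\<forall>C\<in>rcosets H. \<exists>!t. t \<in> C \<inter> T) \<longleftrightarrow> (\<forall>i\<in>{0..<int n}. \<exists>!t. t \<in> T \<and> \<kappa> t = i)"
    by (simp only: rcosets ball_simps)
  also have "\<dots> \<longleftrightarrow> bij_betw \<kappa> T {0..<int n}"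
  proof
    assume unique: "\<forall>i\<in>{0..<int n}. \<exists>!t. t \<in> T \<and> \<kappa> t = i"
    show "bij_betw \<kappa> T {0..<int n}"
    proof (rule bij_betw_imageI)
      show "inj_on \<kappa> T"
        using unique \<kappa>_in True by (intro inj_onI) blast
      show "\<kappa> ` T = {0..<int n}"
        using unique \<kappa>_in True by blast
    qed
  next
    assume bij: "bij_betw \<kappa> T {0..<int n}"
    show "\<forall>i\<in>{0..<int n}. \<exists>!t. t \<in> T \<and> \<kappa> t = i"
    proof
      fix i assume "i \<in> {0..<int n}"
      then obtain t where "t \<in> T" "\<kappa> t = i"
        using bij by (metis bij_betw_imp_surj_on imageE)
      then show "\<exists>!t. t \<in> T \<and> \<kappa> t = i"
        using bij_betw_imp_inj_on[OF bij] by (metis inj_onD)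
    qed
  qed
  finally show ?thesis
    using True by (simp add: NRT_def)
qed (auto simp: NRT_def)

text \<open>A transversal is determined by the cosets that it represents by an element \<open>q r\<^sup>i\<close>.\<close>

definition reflected_cosets :: "'a set \<Rightarrow> int set" where
  "reflected_cosets T = \<kappa> ` {t \<in> T. \<sigma> t}"

lemma reflected_cosets_NRT:
  "reflected_cosets ` NRT G H = {B. B \<subseteq> {0..<int n} \<and> 0 \<notin> B}"
proof (intro equalityI subsetI)
  fix B assume "B \<in> reflected_cosets ` NRT G H"
  then obtain T where T: "T \<in> NRT G H" "B = reflected_cosets T" by blast
  then have T': "T \<subseteq> carrier G" "\<one> \<in> T" "inj_on \<kappa> T"
    by (auto simp: NRT_iff bij_betw_def)
  have "t = \<one>" if "t \<in> T" "\<kappa> t = 0" for t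
    using T' that \<kappa>_one by (metis inj_onD)
  then have "0 \<notin> B" using \<sigma>_one by (auto simp: T reflected_cosets_def)
  moreover have "B \<subseteq> {0..<int n}"
    using T' \<kappa>_in by (auto simp: T reflected_cosets_def subset_eq)
  ultimately show "B \<in> {B. B \<subseteq> {0..<int n} \<and> 0 \<notin> B}" by blast
next
  fix B assume B: "B \<in> {B. B \<subseteq> {0..<int n} \<and> 0 \<notin> B}"
  define T where "T = {x \<in> carrier G. \<sigma> x \<longleftrightarrow> \<kappa> x \<in> B}"
  have surj: "\<exists>x\<in>carrier G. \<kappa> x = i \<and> \<sigma> x = b" if "i \<in> {0..<int n}" for i b
  proof -
    have "(i, b) \<in> (\<lambda>x. (\<kappa> x, \<sigma> x)) ` carrier G"
      using coordinates that by (simp add: bij_betw_def)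
    then show ?thesis by auto
  qed
  have "inj_on \<kappa> T"
  proof (rule inj_onI)
    fix x y assume "x \<in> T" "y \<in> T" "\<kappa> x = \<kappa> y"
    then show "x = y"
      using coordinates unfolding bij_betw_def inj_on_def T_def by simp
  qed
  moreover have "\<kappa> ` T = {0..<int n}"
  proof (intro equalityI subsetI)
    fix i assume "i \<in> {0..<int n}"
    then obtain x where "x \<in> carrier G" "\<kappa> x = i" "\<sigma> x = (i \<in> B)"
      using surj by blast
    then show "i \<in> \<kappa> ` T" by (auto simp: T_def)
  qed (use \<kappa>_in in \<open>auto simp: T_def\<close>)
  ultimately have "T \<in> NRT G H"
    using B \<kappa>_one \<sigma>_one by (auto simp: NRT_iff bij_betw_def T_def)
  moreover have "reflected_cosets T = B"
  proof (intro equalityI subsetI)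
    fix i assume i: "i \<in> B"
    with B obtain x where "x \<in> carrier G" "\<kappa> x = i" "\<sigma> x"
      using surj by blast
    with i show "i \<in> reflected_cosets T" by (auto simp: reflected_cosets_def T_def)
  qed (auto simp: reflected_cosets_def T_def)
  ultimately show "B \<in> reflected_cosets ` NRT G H" by blast
qed

text \<open>Restricted to \<open>T\<close>, the coset index \<open>\<kappa>\<close> is an isomorphism: the coset of \<open>u \<otimes> v\<close> depends only on the
  cosets of \<open>u\<close> and \<open>v\<close> and on \<open>\<sigma> v\<close>, and on \<open>T\<close> the last is a function of the coset of \<open>v\<close>.\<close>

lemma isotopic_nrt_op_twisted_add:
  assumes "subgroup H G" and T: "T \<in> NRT G H"
  shows "isotopic T (nrt_op G H T) {0..<int n} (twisted_add n (reflected_cosets T))"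
proof -
  have T': "T \<subseteq> carrier G" and bij: "bij_betw \<kappa> T {0..<int n}"
    using T by (auto simp: NRT_iff)
  have "twisted_add n (reflected_cosets T) (\<kappa> u) (\<kappa> v) = \<kappa> (nrt_op G H T u v)"
    if "u \<in> T" "v \<in> T" for u v
  proof -
    have uv: "u \<in> carrier G" "v \<in> carrier G" using that T' by auto
    have "\<kappa> v \<in> reflected_cosets T \<longleftrightarrow> \<sigma> v"
      using bij that(2) by (auto simp: reflected_cosets_def bij_betw_def inj_on_eq_iff)
    then have "twisted_add n (reflected_cosets T) (\<kappa> u) (\<kappa> v) = \<kappa> (u \<otimes> v)"
      using uv by (simp add: twisted_add_def \<kappa>_mult)
    also have "\<dots> = \<kappa> (nrt_op G H T u v)"
      using nrt_op_in[OF assms that] uv by (simp add: r_coset_eq)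
    finally show ?thesis .
  qed
  with bij show ?thesis unfolding isotopic_def by blast
qed

end

text \<open>The generator is an involution, and a nontrivial rotation is none because its order is odd.\<close>

lemma order_2_subgroup_dihedral:
  assumes "odd n" "n > 1" "subgroup K (dihedral_group n)" "card K = 2"
  obtains c where "c \<in> {0..<int n}" "K = {(0, False), (c, True)}"
proof -
  let ?D = "dihedral_group n"
  interpret D: group ?D using assms(2) by (simp add: group_dihedral_group)
  have one: "(0, False) \<in> K"
    using subgroup.one_closed[OF assms(3)] by (simp add: dihedral_group_def)
  obtain x where K: "K = {(0, False), x}" and x: "x \<noteq> (0, False)"
    using assms(4) one by (auto simp: card_2_iff doubleton_eq_iff)
  obtain c b where x_eq: "x = (c, b)" by force
  have "x \<in> carrier ?D" using subgroup.subset[OF assms(3)] K by blast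
  then have c: "c \<in> {0..<int n}" by (simp add: x_eq dihedral_group_def)
  have sq: "x \<otimes>\<^bsub>?D\<^esub> x \<in> K" using subgroup.m_closed[OF assms(3), of x x] K by simp
  have b
  proof (rule ccontr)
    assume "\<not> b"
    with x x_eq have "c \<noteq> 0" by simp
    from sq \<open>\<not> b\<close> have "(c + c) mod int n = 0 \<or> (c + c) mod int n = c"
      by (auto simp: K x_eq dihedral_group_def)
    then have "int n dvd c + c \<or> int n dvd c"
      by (metis add_diff_cancel_right' dvd_eq_mod_eq_0 minus_mod_eq_mult_div mod_0_imp_dvd
          dvd_minus_mod)
    moreover have "coprime (int n) 2" using assms(1) by simp
    ultimately have "int n dvd c"
      by (metis coprime_dvd_mult_right_iff mult_2)
    with c \<open>c \<noteq> 0\<close> show False using zdvd_not_zless by force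
  qed
  with c K x_eq show thesis by (intro that) auto
qed

lemma exists_dihedral_coordinates:
  fixes G :: "('a, 'b) monoid_scheme"
  assumes "odd n" "n > 1" "group G" "G \<cong> dihedral_group n" "subgroup H G" "card H = 2"
  obtains \<kappa> \<sigma> where "dihedral_coordinates G H n \<kappa> \<sigma>"
proof -
  let ?D = "dihedral_group n"
  interpret group G by fact
  interpret D: group ?D using assms(2) by (simp add: group_dihedral_group)
  obtain \<phi> where \<phi>: "\<phi> \<in> iso G ?D" using assms(4) by (auto simp: is_iso_def)
  then have hom: "\<phi> \<in> hom G ?D" and bij: "bij_betw \<phi> (carrier G) (carrier ?D)"
    by (auto simp: iso_def)
  interpret \<phi>: group_hom G ?D \<phi> using hom by unfold_locales
  have H: "H \<subseteq> carrier G" using subgroup.subset[OF assms(5)] .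
  have "subgroup (\<phi> ` H) ?D" using \<phi>.subgroup_img_is_subgroup[OF assms(5)] .
  moreover have "card (\<phi> ` H) = 2"
    using assms(6) bij H by (metis bij_betw_def card_image inj_on_subset)
  ultimately obtain c where c: "c \<in> {0..<int n}" and \<phi>H: "\<phi> ` H = {(0, False), (c, True)}"
    using order_2_subgroup_dihedral[OF assms(1,2)] by metis
  \<comment> \<open>With \<open>r\<^sup>c q\<close> as the generator of \<open>H\<close>, the reflection \<open>r\<^sup>a q\<close> equals \<open>(r\<^sup>c q) r\<^sup>c\<^sup>-\<^sup>a\<close>.\<close>
  define \<psi> where "\<psi> = (\<lambda>(a, s). (if s then (c - a) mod int n else a, s))"
  define \<kappa> where "\<kappa> x = fst (\<psi> (\<phi> x))" for x
  define \<sigma> where "\<sigma> x = snd (\<psi> (\<phi> x))" for x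
  have "dihedral_coordinates G H n \<kappa> \<sigma>"
  proof
    show "n > 1" by fact
    have carrier: "carrier ?D = {0..<int n} \<times> UNIV" by (simp add: dihedral_group_def)
    have "bij_betw \<psi> (carrier ?D) ({0..<int n} \<times> UNIV)"
      using assms(2) unfolding carrier
      by (intro bij_betw_byWitness[where f' = \<psi>]) (auto simp: \<psi>_def mod_simps)
    from bij_betw_trans[OF bij this]
    show "bij_betw (\<lambda>x. (\<kappa> x, \<sigma> x)) (carrier G) ({0..<int n} \<times> UNIV)"
      by (simp add: \<kappa>_def \<sigma>_def comp_def)
    show "\<kappa> (x \<otimes>\<^bsub>G\<^esub> y) = ((if \<sigma> y then - 1 else 1) * \<kappa> x + \<kappa> y) mod int n"
      if "x \<in> carrier G" "y \<in> carrier G" for x y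
    proof -
      obtain a s b t where "\<phi> x = (a, s)" "\<phi> y = (b, t)" by fastforce
      with that show ?thesis
        by (cases s; cases t; simp add: \<kappa>_def \<sigma>_def \<psi>_def dihedral_group_def mod_simps;
            simp add: algebra_simps)
    qed
    show "\<not> \<sigma> \<one>\<^bsub>G\<^esub>" by (simp add: \<sigma>_def \<psi>_def) (simp add: dihedral_group_def)
    show "H = {x \<in> carrier G. \<kappa> x = 0}"
    proof -
      have \<psi>_0: "fst (\<psi> p) = 0 \<longleftrightarrow> p \<in> \<phi> ` H" if "p \<in> carrier ?D" for p
      proof -
        obtain a s where p: "p = (a, s)" by force
        have "(c - a) mod int n = 0 \<longleftrightarrow> a = c"
          using that c by (auto simp: p carrier mod_eq_dvd_iff[symmetric] dvd_eq_mod_eq_0[symmetric])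
        then show ?thesis by (auto simp: p \<psi>_def \<phi>H)
      qed
      have "\<kappa> x = 0 \<longleftrightarrow> x \<in> H" if "x \<in> carrier G" for x
        unfolding \<kappa>_def using \<psi>_0[OF \<phi>.hom_closed[OF that]]
          inj_on_image_mem_iff[OF bij_betw_imp_inj_on[OF bij] that H] by blast
      then show ?thesis using H by blast
    qed
  qed
  then show thesis by (rule that)
qed

lemma card_quotient_kernel:
  "card (A // {(x, y). x \<in> A \<and> y \<in> A \<and> F x = F y}) = card (F ` A)"
proof -
  let ?r = "{(x, y). x \<in> A \<and> y \<in> A \<and> F x = F y}"
  have "A // ?r = (\<lambda>x. ?r `` {x}) ` A"
    unfolding quotient_def by blast
  also have "\<dots> = (\<lambda>x. {y \<in> A. F y = F x}) ` A"
    by (rule image_cong) auto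
  finally have "A // ?r = (\<lambda>z. {y \<in> A. F y = z}) ` F ` A"
    by (simp only: image_image)
  moreover have "inj_on (\<lambda>z. {y \<in> A. F y = z}) (F ` A)"
    by (rule inj_onI) blast
  ultimately show ?thesis by (simp add: card_image)
qed

theorem theorem2p2:
  fixes G :: "('a, 'b) monoid_scheme" and H :: "'a set" and n :: nat
  assumes "odd n" and "n > 1"
    and "group G" and "G \<cong> dihedral_group n"
    and "subgroup H G" and "card H = 2"
  shows "(of_nat (card (Itp G H)) :: rat) = cycle_index {0..<int n} (Aff1 n) (\<lambda>_. 2) / 2"
proof -
  let ?Z = "{0..<int n}"
  obtain \<kappa> \<sigma> where "dihedral_coordinates G H n \<kappa> \<sigma>"
    using exists_dihedral_coordinates[OF assms] .
  then interpret dihedral_coordinates G H n \<kappa> \<sigma> .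
  define F where "F T = affine_orbit n (lighter_side n (reflected_cosets T))" for T
  have "isotopic S (nrt_op G H S) T (nrt_op G H T) \<longleftrightarrow> F S = F T"
    if S: "S \<in> NRT G H" and T: "T \<in> NRT G H" for S T
  proof -
    have "isotopic S (nrt_op G H S) T (nrt_op G H T) \<longleftrightarrow>
        isotopic ?Z (twisted_add n (reflected_cosets S)) ?Z (twisted_add n (reflected_cosets T))"
    proof -
      have closed: "nrt_op G H S u v \<in> S" if "u \<in> S" "v \<in> S" for u v
        using nrt_op_in[OF assms(5) S that] by blast
      have closed': "nrt_op G H T u v \<in> T" if "u \<in> T" "v \<in> T" for u v
        using nrt_op_in[OF assms(5) T that] by blast
      note iso = isotopic_nrt_op_twisted_add[OF assms(5) S] isotopic_nrt_op_twisted_add[OF assms(5) T]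
      note sym = isotopic_sym[OF iso(1) closed] isotopic_sym[OF iso(2) closed']
      show ?thesis
        using iso sym isotopic_trans by metis
    qed
    also have "\<dots> \<longleftrightarrow> F S = F T"
      unfolding F_def using S T reflected_cosets_NRT
      by (intro isotopic_twisted_add_iff assms) blast+
    finally show ?thesis .
  qed
  then have "nrt_isotopy_rel G H = {(S, T). S \<in> NRT G H \<and> T \<in> NRT G H \<and> F S = F T}"
    by (auto simp: nrt_isotopy_rel_def)
  then have "card (Itp G H) = card (F ` NRT G H)"
    unfolding Itp_def by (simp only: card_quotient_kernel)
  also have "F ` NRT G H = (\<lambda>B. affine_orbit n (lighter_side n B)) ` reflected_cosets ` NRT G H"
    by (simp add: F_def image_image)
  also have "\<dots> = light_affine_orbits n"
    unfolding reflected_cosets_NRT by (rule lighter_side_orbits[OF assms(1,2)])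
  finally show ?thesis
    by (simp add: cycle_index_Aff1_2[OF assms(2)] card_affine_orbits[OF assms(1,2)])
qed

end
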